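(* Let $G$ be a compact virtually abelian group and let $E\in\Omega_c(G)$. Then $\bigcup_{x\in E}C_x\in\Omega_c(G)$, where $C_x=\{yxy^{-1}:y\in G\}$ is the conjugacy class of $x$.
   Context: A compact group is virtually abelian if it has an abelian subgroup of finite index. A coset in $G$ is a subset $K$ such that $x,y,z\in K$ implies $xy^{-1}z\in K$. $\Omega(G)$ is the Boolean algebra of subsets of $G$ generated by all cosets in $G$ (of arbitrary, not necessarily closed, subgroups), and $\Omega_c(G)$ is the family of those elements of $\Omega(G)$ which are closed in $G$. *)

theory Defs
  imports "HOL-Analysis.Analysis" "HOL-Algebra.Coset"
begin

(* "Compact group" includes the Hausdorff axiom, as is customary. *)
locale compact_group = group G for G (structure) and T +
  assumes topspace_eq: "topspace T = carrier G"
    and continuous_mult: "continuous_map (prod_topology T T) T (\<lambda>(x, y). x \<otimes> y)"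
    and continuous_inv: "continuous_map T T (\<lambda>x. inv x)"
    and compact_space_T: "compact_space T"
    and Hausdorff_space_T: "Hausdorff_space T"

(* The subgroup H is not required to be closed. *)
definition virtually_abelian :: "('a, 'b) monoid_scheme \<Rightarrow> bool" where
  "virtually_abelian G \<longleftrightarrow>
    (\<exists>H. subgroup H G \<and> comm_group (G\<lparr>carrier := H\<rparr>) \<and> finite (rcosets\<^bsub>G\<^esub> H))"

(* The empty set satisfies this condition; it belongs to the generated Boolean algebra anyway. *)
definition is_coset :: "('a, 'b) monoid_scheme \<Rightarrow> 'a set \<Rightarrow> bool" where
  "is_coset G K \<longleftrightarrow> K \<subseteq> carrier G \<and>
    (\<forall>x\<in>K. \<forall>y\<in>K. \<forall>z\<in>K. x \<otimes>\<^bsub>G\<^esub> inv\<^bsub>G\<^esub> y \<otimes>\<^bsub>G\<^esub> z \<in> K)"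

(* The smallest algebra of subsets of the carrier that contains all cosets. The qualified name
   avoids a clash with the locale of algebras over a ring in HOL-Algebra. *)
definition coset_algebra :: "('a, 'b) monoid_scheme \<Rightarrow> 'a set set" where
  "coset_algebra G = Sigma_Algebra.algebra (carrier G) hull {K. is_coset G K}"

definition closed_coset_algebra ::
    "('a, 'b) monoid_scheme \<Rightarrow> 'a topology \<Rightarrow> 'a set set" where
  "closed_coset_algebra G T = {E \<in> coset_algebra G. closedin T E}"

definition conjugacy_class :: "('a, 'b) monoid_scheme \<Rightarrow> 'a \<Rightarrow> 'a set" where
  "conjugacy_class G x = {y \<otimes>\<^bsub>G\<^esub> x \<otimes>\<^bsub>G\<^esub> inv\<^bsub>G\<^esub> y | y. y \<in> carrier G}"

end

theory Submission
  imports Defs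
begin

text \<open>
  Closedness and membership in the algebra of cosets have separate reasons. The saturation of a closed
  set \<open>E\<close> is the image of the compact set \<open>G \<times> E\<close> under the continuous map
  \<open>(y, x) \<mapsto> y x y\<inverse>\<close>, hence closed.

  Membership is purely algebraic: in a virtually abelian group the saturation of every element
  \<open>E\<close> of the algebra is again in the algebra. Let \<open>H\<close> be an abelian subgroup of
  finite index. Since \<open>E\<close> splits into finitely many pieces \<open>E \<inter> tH\<close>, one such piece may be
  considered. The subgroup \<open>A = H \<inter> tHt\<inverse>\<close> has finite index as well. For \<open>a \<in> A\<close> and
  \<open>x = th\<close>, commutativity of \<open>H\<close> gives \<open>a x a\<inverse> = x \<phi>(a)\<close> with \<open>\<phi>(a) = t\<inverse>ata\<inverse> \<in> H\<close> independent
  of \<open>h\<close>, and \<open>\<phi>\<close> is a homomorphism on \<open>A\<close>. So conjugation by \<open>A\<close> replaces \<open>E \<inter> tH\<close> by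
  \<open>(E \<inter> tH) B\<close> with the subgroup \<open>B = \<phi>(A)\<close> of \<open>H\<close>, and the remaining conjugations are by
  finitely many representatives of \<open>G / A\<close>.

  What is left is that multiplication by \<open>B\<close> preserves the algebra
  (\<open>coset_difference_set_mult\<close>). This is quantifier elimination in the style of Baur and Monk: by
  a normal form it suffices to treat a coset minus finitely many cosets, and B. H. Neumann's
  covering lemma (\<open>neumann_covering\<close>) shows that removing cosets changes the product with \<open>B\<close> only
  if one of them has finite index in the direction of \<open>B\<close>; such a coset can be traded for
  finitely many translates, with one coset fewer to remove.
\<close>

section \<open>The algebra generated by the cosets\<close>

lemma coset_algebra_induct:
  assumes "E \<in> coset_algebra G"
    and "Sigma_Algebra.algebra (carrier G) M"
    and "\<And>K. is_coset G K \<Longrightarrow> K \<in> M"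
  shows "E \<in> M"
  using assms unfolding coset_algebra_def hull_def by auto

lemma coset_in_coset_algebra: "is_coset G K \<Longrightarrow> K \<in> coset_algebra G"
  unfolding coset_algebra_def hull_def by auto

lemma algebra_coset_algebra: "Sigma_Algebra.algebra (carrier G) (coset_algebra G)"
proof -
  have "coset_algebra G \<subseteq> Pow (carrier G)"
    using coset_algebra_induct[OF _ algebra_Pow[of "carrier G"]] by (auto simp: is_coset_def)
  moreover have "{} \<in> coset_algebra G"
    by (rule coset_in_coset_algebra) (simp add: is_coset_def)
  moreover have "carrier G - a \<in> coset_algebra G" if "a \<in> coset_algebra G" for a
    using that unfolding coset_algebra_def hull_def by (auto simp: algebra_iff_Un)
  moreover have "a \<union> b \<in> coset_algebra G" if "a \<in> coset_algebra G" "b \<in> coset_algebra G" for a b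
    using that unfolding coset_algebra_def hull_def by (auto simp: algebra_iff_Un)
  ultimately show ?thesis
    by (simp add: algebra_iff_Un)
qed

lemma coset_algebra_subset: "E \<in> coset_algebra G \<Longrightarrow> E \<subseteq> carrier G"
  using algebra_coset_algebra[of G] by (auto simp: algebra_iff_Un)

lemma coset_algebra_Un:
  "\<lbrakk>E \<in> coset_algebra G; F \<in> coset_algebra G\<rbrakk> \<Longrightarrow> E \<union> F \<in> coset_algebra G"
  using algebra_coset_algebra[of G] by (auto simp: algebra_iff_Un)

lemma coset_algebra_Diff:
  "\<lbrakk>E \<in> coset_algebra G; F \<in> coset_algebra G\<rbrakk> \<Longrightarrow> E - F \<in> coset_algebra G"
  using algebra_coset_algebra[of G] by (rule ring_of_sets.Diff[OF algebra.axioms(1)])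

lemma coset_algebra_UN:
  assumes "finite I" "\<And>i. i \<in> I \<Longrightarrow> F i \<in> coset_algebra G"
  shows "(\<Union>i\<in>I. F i) \<in> coset_algebra G"
  using ring_of_sets.finite_UN[OF algebra.axioms(1)[OF algebra_coset_algebra[of G]]] assms
  by blast

lemma is_coset_Int: "\<lbrakk>is_coset G K; is_coset G L\<rbrakk> \<Longrightarrow> is_coset G (K \<inter> L)"
  unfolding is_coset_def by blast

definition coset_differences :: "('a, 'b) monoid_scheme \<Rightarrow> 'a set set" where
  "coset_differences G =
    {K - \<Union>\<L> | K \<L>. is_coset G K \<and> finite \<L> \<and> (\<forall>L\<in>\<L>. is_coset G L)}"

lemma coset_differencesI:
  "\<lbrakk>is_coset G K; finite \<L>; \<And>L. L \<in> \<L> \<Longrightarrow> is_coset G L\<rbrakk> \<Longrightarrow> K - \<Union>\<L> \<in> coset_differences G"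
  unfolding coset_differences_def by blast

lemma coset_differences_Int:
  assumes "D \<in> coset_differences G" "D' \<in> coset_differences G"
  shows "D \<inter> D' \<in> coset_differences G"
proof -
  obtain K \<L> where D: "D = K - \<Union>\<L>" "is_coset G K" "finite \<L>" "\<forall>L\<in>\<L>. is_coset G L"
    using assms(1) unfolding coset_differences_def by blast
  obtain K' \<L>' where D': "D' = K' - \<Union>\<L>'" "is_coset G K'" "finite \<L>'" "\<forall>L\<in>\<L>'. is_coset G L"
    using assms(2) unfolding coset_differences_def by blast
  have "D \<inter> D' = (K \<inter> K') - \<Union>(\<L> \<union> \<L>')"
    using D D' by blast
  also have "\<dots> \<in> coset_differences G"
    by (rule coset_differencesI) (use D D' is_coset_Int in blast)+
  finally show ?thesis .
qed

context group
begin

lemma set_mult_memI: "\<lbrakk>x \<in> K; b \<in> B\<rbrakk> \<Longrightarrow> x \<otimes> b \<in> K <#> B"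
  unfolding set_mult_def by blast

lemma cancel_inv_mult:
  assumes "x \<in> carrier G" "y \<in> carrier G"
  shows "x \<otimes> (inv x \<otimes> y) = y" "inv x \<otimes> (x \<otimes> y) = y"
  using assms by (simp_all flip: m_assoc)

text \<open>The finite unions of sets in \<^term>\<open>coset_differences G\<close> already form an algebra: intersections
  distribute over the unions, and the complement of a coset minus finitely many cosets is the
  complement of one coset together with finitely many cosets.\<close>

lemma coset_algebra_normal_form:
  assumes "E \<in> coset_algebra G"
  obtains \<D> where "finite \<D>" "\<D> \<subseteq> coset_differences G" "E = \<Union>\<D>"
proof -
  define R where "R = {\<Union>\<D> | \<D>. finite \<D> \<and> \<D> \<subseteq> coset_differences G}"
  have R_I: "\<Union>\<D> \<in> R" if "finite \<D>" "\<D> \<subseteq> coset_differences G" for \<D>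
    using that unfolding R_def by blast
  have R_D: "D \<in> R" if "D \<in> coset_differences G" for D
    using R_I[of "{D}"] that by simp
  have R_Un: "E \<union> F \<in> R" if "E \<in> R" "F \<in> R" for E F
    using that R_I[of "_ \<union> _"] unfolding R_def by (auto simp flip: Union_Un_distrib)
  have R_Int: "E \<inter> F \<in> R" if EF: "E \<in> R" "F \<in> R" for E F
  proof -
    obtain \<D> \<D>' where *: "finite \<D>" "\<D> \<subseteq> coset_differences G" "E = \<Union>\<D>"
        "finite \<D>'" "\<D>' \<subseteq> coset_differences G" "F = \<Union>\<D>'"
      using EF unfolding R_def by blast
    have "\<Union>((\<lambda>(D, D'). D \<inter> D') ` (\<D> \<times> \<D>')) \<in> R"
      by (rule R_I) (use * in \<open>auto intro!: coset_differences_Int\<close>)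
    moreover have "\<Union>((\<lambda>(D, D'). D \<inter> D') ` (\<D> \<times> \<D>')) = E \<inter> F"
      using * by auto
    ultimately show ?thesis by simp
  qed
  have coset_R: "K \<in> R" if "is_coset G K" for K
    using R_D[OF coset_differencesI[OF that, of "{}"]] by simp
  have carrier: "is_coset G (carrier G)"
    by (simp add: is_coset_def)
  have compl_D: "carrier G - D \<in> R" if D: "D \<in> coset_differences G" for D
  proof -
    obtain K \<L> where K: "D = K - \<Union>\<L>" "is_coset G K" "finite \<L>" "\<forall>L\<in>\<L>. is_coset G L"
      using D unfolding coset_differences_def by blast
    have "L \<in> coset_differences G" if "L \<in> \<L>" for L
      using coset_differencesI[of G L "{}"] K(4) that by simp
    then have "\<Union>\<L> \<in> R"
      using K(3) by (intro R_I) auto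
    moreover have "carrier G - \<Union>{K} \<in> R"
      by (intro R_D coset_differencesI carrier) (use K in auto)
    moreover have "carrier G - D = (carrier G - \<Union>{K}) \<union> \<Union>\<L>"
      using K by (auto simp: is_coset_def)
    ultimately show ?thesis using R_Un by simp
  qed
  have compl: "carrier G - \<Union>\<D> \<in> R" if "finite \<D>" "\<D> \<subseteq> coset_differences G" for \<D>
    using that
  proof (induction \<D> rule: finite_induct)
    case empty
    show ?case using coset_R[OF carrier] by simp
  next
    case (insert D \<D>)
    have "carrier G - \<Union>(insert D \<D>) = (carrier G - D) \<inter> (carrier G - \<Union>\<D>)"
      by blast
    then show ?case using insert compl_D R_Int by simp
  qed
  have "Sigma_Algebra.algebra (carrier G) R"
    unfolding algebra_iff_Un
  proof (intro conjI ballI)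
    show "R \<subseteq> Pow (carrier G)"
      unfolding R_def coset_differences_def is_coset_def by blast
    show "{} \<in> R"
      using R_I[of "{}"] by simp
    show "carrier G - E \<in> R" if "E \<in> R" for E
    proof -
      obtain \<D> where "finite \<D>" "\<D> \<subseteq> coset_differences G" "E = \<Union>\<D>"
        using \<open>E \<in> R\<close> by (auto simp: R_def)
      then show ?thesis using compl by simp
    qed
  qed (rule R_Un)
  then have "E \<in> R"
    using coset_algebra_induct[OF assms] coset_R by blast
  then obtain \<D> where "finite \<D>" "\<D> \<subseteq> coset_differences G" "E = \<Union>\<D>"
    by (auto simp: R_def)
  then show thesis by (rule that)
qed

text \<open>Conjugation by \<open>s\<close> is an automorphism, so the sets whose image lies in the algebra of cosets form
  an algebra that contains all cosets.\<close>

lemma coset_algebra_conjugate: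
  assumes E: "E \<in> coset_algebra G" and s: "s \<in> carrier G"
  shows "(\<lambda>x. s \<otimes> x \<otimes> inv s) ` E \<in> coset_algebra G"
proof -
  let ?c = "\<lambda>x. s \<otimes> x \<otimes> inv s"
  define M where "M = {E. E \<subseteq> carrier G \<and> ?c ` E \<in> coset_algebra G}"
  have inj: "inj_on ?c (carrier G)"
    using s by (intro inj_onI) simp
  have surj: "?c ` carrier G = carrier G"
  proof
    show "carrier G \<subseteq> ?c ` carrier G"
    proof
      fix x assume "x \<in> carrier G"
      then have "x = ?c (inv s \<otimes> x \<otimes> s)" "inv s \<otimes> x \<otimes> s \<in> carrier G"
        using s by (simp_all add: m_assoc cancel_inv_mult)
      then show "x \<in> ?c ` carrier G" by blast
    qed
  qed (use s in auto)
  have "Sigma_Algebra.algebra (carrier G) M"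
    unfolding algebra_iff_Un
  proof (intro conjI ballI)
    show "{} \<in> M"
      using coset_in_coset_algebra[of G "{}"] by (simp add: M_def is_coset_def)
    show "carrier G - E \<in> M" if "E \<in> M" for E
    proof -
      have "?c ` (carrier G - E) = carrier G - ?c ` E"
        using that inj_on_image_set_diff[OF inj, of "carrier G" E] surj by (auto simp: M_def)
      moreover have "carrier G \<in> coset_algebra G"
        by (rule coset_in_coset_algebra) (simp add: is_coset_def)
      ultimately show ?thesis
        using that coset_algebra_Diff by (auto simp: M_def)
    qed
    show "E \<union> F \<in> M" if "E \<in> M" "F \<in> M" for E F
      using that coset_algebra_Un by (auto simp: M_def image_Un)
  qed (auto simp: M_def)
  moreover have "K \<in> M" if K: "is_coset G K" for K
  proof -
    have hom: "?c x \<otimes> inv (?c y) \<otimes> ?c z = ?c (x \<otimes> inv y \<otimes> z)"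
      if "x \<in> carrier G" "y \<in> carrier G" "z \<in> carrier G" for x y z
      using that s by (simp add: m_assoc inv_mult_group cancel_inv_mult)
    have "is_coset G (?c ` K)"
      unfolding is_coset_def
    proof (intro conjI ballI)
      show "?c ` K \<subseteq> carrier G"
        using K s by (auto simp: is_coset_def)
      fix x y z assume "x \<in> ?c ` K" "y \<in> ?c ` K" "z \<in> ?c ` K"
      then obtain x' y' z' where *: "x = ?c x'" "y = ?c y'" "z = ?c z'"
        "x' \<in> K" "y' \<in> K" "z' \<in> K" by blast
      then have "x' \<otimes> inv y' \<otimes> z' \<in> K" "x' \<in> carrier G" "y' \<in> carrier G" "z' \<in> carrier G"
        using K by (auto simp: is_coset_def)
      then show "x \<otimes> inv y \<otimes> z \<in> ?c ` K"
        unfolding * by (subst hom) auto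
    qed
    then show ?thesis
      using K coset_in_coset_algebra by (simp add: M_def is_coset_def[of G K])
  qed
  ultimately have "E \<in> M"
    using coset_algebra_induct[OF E] by blast
  then show ?thesis by (simp add: M_def)
qed

section \<open>Covering a group by finitely many cosets\<close>

text \<open>B. H. Neumann's lemma, in a form that allows induction on the set of subgroups: if \<open>S N\<close> misses
  some \<open>g\<close>, then the coset \<open>g N\<close> is disjoint from \<open>S N\<close> and hence covered by cosets of the other
  subgroups. Translating this covering covers all of \<open>S N\<close>, so \<open>N\<close> can be dropped.\<close>

lemma neumann_covering:
  assumes "finite \<N>" "subgroup C G" "\<And>N. N \<in> \<N> \<Longrightarrow> subgroup N G \<and> N \<subseteq> C"
    and "finite S" "S \<subseteq> C" "C \<subseteq> (\<Union>N\<in>\<N>. S <#> N)"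
  shows "\<exists>N\<in>\<N>. \<exists>S'. finite S' \<and> S' \<subseteq> C \<and> C \<subseteq> S' <#> N"
  using assms(1,3-)
proof (induction \<N> arbitrary: S rule: finite_induct)
  case empty
  then show ?case
    using subgroup.one_closed[OF assms(2)] by auto
next
  case (insert N \<N>)
  interpret C: subgroup C G by fact
  interpret N: subgroup N G using insert.prems by auto
  show ?case
  proof (cases "C \<subseteq> S <#> N")
    case True
    then show ?thesis using insert.prems by blast
  next
    case False
    then obtain g where g: "g \<in> C" "g \<notin> S <#> N" by blast
    \<comment> \<open>For \<open>s\<close> in \<open>S\<close>, the translate of \<open>g N\<close> by \<open>s g\<inverse>\<close> is \<open>s N\<close>; this carries a covering of
      \<open>g N\<close> by cosets \<open>s' M\<close> to one by \<open>s g\<inverse> s' M\<close>.\<close>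
    define S' where "S' = S \<union> (\<lambda>(s, s'). s \<otimes> inv g \<otimes> s') ` (S \<times> S)"
    have "C \<subseteq> (\<Union>M\<in>\<N>. S' <#> M)"
    proof
      fix c assume c: "c \<in> C"
      show "c \<in> (\<Union>M\<in>\<N>. S' <#> M)"
      proof (cases "c \<in> S <#> N")
        case False
        then show ?thesis
          using c insert.prems(4) by (fastforce simp: S'_def set_mult_def)
      next
        case True
        then obtain s n where s: "s \<in> S" "n \<in> N" "c = s \<otimes> n"
          by (auto simp: set_mult_def)
        have gn: "g \<otimes> n \<notin> S <#> N"
        proof
          assume "g \<otimes> n \<in> S <#> N"
          then obtain s' n' where s': "s' \<in> S" "n' \<in> N" "g \<otimes> n = s' \<otimes> n'"
            by (auto simp: set_mult_def)
          have "s' \<in> carrier G" using s'(1) insert.prems(3) by auto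
          then have "g = s' \<otimes> (n' \<otimes> inv n)"
            using s' s(2) g(1) by (metis C.mem_carrier N.mem_carrier N.m_inv_closed m_assoc inv_solve_right m_closed)
          then show False
            using g(2) s s' by (auto simp: set_mult_def)
        qed
        have "g \<otimes> n \<in> C"
          using g(1) s(2) insert.prems(1)[of N] by auto
        then obtain M where M: "M \<in> \<N>" "g \<otimes> n \<in> S <#> M"
          using gn insert.prems(4) by blast
        then obtain s' m where s': "s' \<in> S" "m \<in> M" "g \<otimes> n = s' \<otimes> m"
          by (auto simp: set_mult_def)
        have car: "s \<in> carrier G" "s' \<in> carrier G" "m \<in> carrier G" "g \<in> carrier G" "n \<in> carrier G"
          using s s' g M(1) insert.prems(1)[of M] insert.prems(3) by auto
        have "c = s \<otimes> inv g \<otimes> (g \<otimes> n)"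
          using car by (simp add: s(3) m_assoc cancel_inv_mult)
        also have "\<dots> = (s \<otimes> inv g \<otimes> s') \<otimes> m"
          using car by (simp add: s'(3) m_assoc)
        finally have "c \<in> S' <#> M"
          using s(1) s'(1,2) by (force simp: S'_def set_mult_def)
        then show ?thesis using M(1) by blast
      qed
    qed
    moreover have "finite S'"
      using insert.prems(2) by (simp add: S'_def)
    moreover have "S' \<subseteq> C"
      using insert.prems(3) g(1) by (auto simp: S'_def)
    ultimately show ?thesis
      using insert.IH[of S'] insert.prems(1) by blast
  qed
qed

section \<open>Multiplying by an abelian subgroup\<close>

text \<open>For a nonempty coset \<open>K = kH\<close> this is \<open>B \<inter> H\<close>. The description by translations avoids choosing a
  base point, and makes it a subgroup even for empty \<open>K\<close>.\<close>

definition periods :: "'a set \<Rightarrow> 'a set \<Rightarrow> 'a set" where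
  "periods B K = {b \<in> B. \<forall>k\<in>K. k \<otimes> b \<in> K}"

lemma subgroup_periods:
  assumes "subgroup B G" "is_coset G K"
  shows "subgroup (periods B K) G"
proof -
  interpret B: subgroup B G by fact
  have K: "K \<subseteq> carrier G" "\<And>x y z. \<lbrakk>x \<in> K; y \<in> K; z \<in> K\<rbrakk> \<Longrightarrow> x \<otimes> inv y \<otimes> z \<in> K"
    using assms(2) by (auto simp: is_coset_def)
  show ?thesis
  proof (rule subgroupI)
    show "periods B K \<subseteq> carrier G" by (auto simp: periods_def)
    have "\<one> \<in> periods B K" using K by (auto simp: periods_def)
    then show "periods B K \<noteq> {}" by blast
    fix a assume a: "a \<in> periods B K"
    {
      fix k assume k: "k \<in> K"
      then have "k \<otimes> inv (k \<otimes> a) \<otimes> k \<in> K"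
        using K(2) a by (simp add: periods_def)
      moreover have "k \<otimes> inv (k \<otimes> a) \<otimes> k = k \<otimes> inv a"
        using k K(1) a by (simp add: periods_def subset_iff inv_mult_group m_assoc)
      ultimately have "k \<otimes> inv a \<in> K" by simp
    }
    then show "inv a \<in> periods B K"
      using a by (simp add: periods_def)
    fix b assume b: "b \<in> periods B K"
    show "a \<otimes> b \<in> periods B K"
      using a b K(1) by (auto simp: periods_def subset_iff simp flip: m_assoc)
  qed
qed

text \<open>A translation that keeps one point of a coset inside the coset preserves the whole coset.\<close>

lemma periodsI:
  assumes "subgroup B G" "is_coset G K" "k \<in> K" "b \<in> B" "k \<otimes> b \<in> K"
  shows "b \<in> periods B K"
proof -
  interpret B: subgroup B G by fact
  have K: "K \<subseteq> carrier G" "\<And>x y z. \<lbrakk>x \<in> K; y \<in> K; z \<in> K\<rbrakk> \<Longrightarrow> x \<otimes> inv y \<otimes> z \<in> K"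
    using assms(2) by (auto simp: is_coset_def)
  have "l \<otimes> b \<in> K" if l: "l \<in> K" for l
  proof -
    have "l \<otimes> inv k \<otimes> (k \<otimes> b) = l \<otimes> b"
      using l assms(3,4) K(1) by (simp add: subset_iff m_assoc cancel_inv_mult)
    then show ?thesis
      using K(2)[OF l assms(3,5)] by simp
  qed
  then show ?thesis using assms(4) by (simp add: periods_def)
qed

text \<open>If \<open>K = kH\<close>, the commutation hypothesis says that \<open>H\<close> centralizes \<open>B\<close>, so that \<open>HB\<close> is a
  subgroup. It is stated through quotients of elements of \<open>K\<close> so that it passes to subsets of \<open>K\<close>.\<close>

lemma is_coset_set_mult:
  assumes B: "subgroup B G" and K: "is_coset G K"
    and comm: "\<And>k l b. \<lbrakk>k \<in> K; l \<in> K; b \<in> B\<rbrakk> \<Longrightarrow> inv k \<otimes> l \<otimes> b = b \<otimes> (inv k \<otimes> l)"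
  shows "is_coset G (K <#> B)"
proof -
  interpret B: subgroup B G by fact
  have K': "K \<subseteq> carrier G" "\<And>x y z. \<lbrakk>x \<in> K; y \<in> K; z \<in> K\<rbrakk> \<Longrightarrow> x \<otimes> inv y \<otimes> z \<in> K"
    using K by (auto simp: is_coset_def)
  show ?thesis
    unfolding is_coset_def
  proof (intro conjI ballI)
    show "K <#> B \<subseteq> carrier G"
      using K'(1) B.subset by (rule set_mult_closed)
    fix x y z assume "x \<in> K <#> B" "y \<in> K <#> B" "z \<in> K <#> B"
    then obtain k1 k2 k3 b1 b2 b3 where k: "k1 \<in> K" "k2 \<in> K" "k3 \<in> K" and b: "b1 \<in> B" "b2 \<in> B" "b3 \<in> B"
      and eq: "x = k1 \<otimes> b1" "y = k2 \<otimes> b2" "z = k3 \<otimes> b3"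
      unfolding set_mult_def by blast
    have car: "k1 \<in> carrier G" "k2 \<in> carrier G" "k3 \<in> carrier G"
      "b1 \<in> carrier G" "b2 \<in> carrier G" "b3 \<in> carrier G"
      using k b K'(1) by auto
    have "x \<otimes> inv y \<otimes> z = k1 \<otimes> ((b1 \<otimes> inv b2) \<otimes> (inv k2 \<otimes> k3)) \<otimes> b3"
      using car by (simp add: eq inv_mult_group m_assoc)
    also have "(b1 \<otimes> inv b2) \<otimes> (inv k2 \<otimes> k3) = (inv k2 \<otimes> k3) \<otimes> (b1 \<otimes> inv b2)"
      using comm[OF k(2,3), of "b1 \<otimes> inv b2"] b by simp
    also have "k1 \<otimes> \<dots> \<otimes> b3 = (k1 \<otimes> inv k2 \<otimes> k3) \<otimes> (b1 \<otimes> inv b2 \<otimes> b3)"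
      using car by (simp add: m_assoc)
    also have "\<dots> \<in> K <#> B"
      by (intro set_mult_memI K'(2) k) (use b in auto)
    finally show "x \<otimes> inv y \<otimes> z \<in> K <#> B" .
  qed
qed

lemma is_coset_translate:
  assumes K: "is_coset G K" and s: "s \<in> carrier G"
  shows "is_coset G (K #> s)"
proof -
  have K': "K \<subseteq> carrier G" "\<And>x y z. \<lbrakk>x \<in> K; y \<in> K; z \<in> K\<rbrakk> \<Longrightarrow> x \<otimes> inv y \<otimes> z \<in> K"
    using K by (auto simp: is_coset_def)
  show ?thesis
    unfolding is_coset_def
  proof (intro conjI ballI)
    show "K #> s \<subseteq> carrier G"
      using K'(1) s by (rule r_coset_subset_G)
    fix x y z assume "x \<in> K #> s" "y \<in> K #> s" "z \<in> K #> s"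
    then obtain k1 k2 k3 where k: "k1 \<in> K" "k2 \<in> K" "k3 \<in> K"
      and eq: "x = k1 \<otimes> s" "y = k2 \<otimes> s" "z = k3 \<otimes> s"
      unfolding r_coset_def by blast
    have car: "k1 \<in> carrier G" "k2 \<in> carrier G" "k3 \<in> carrier G"
      using k K'(1) by auto
    have "x \<otimes> inv y \<otimes> z = (k1 \<otimes> inv k2 \<otimes> k3) \<otimes> s"
      using car s by (simp add: eq inv_mult_group m_assoc cancel_inv_mult)
    then show "x \<otimes> inv y \<otimes> z \<in> K #> s"
      using K'(2)[OF k] unfolding r_coset_def by blast
  qed
qed

text \<open>The heart of the proof, by induction on the set \<open>\<L>\<close> of removed cosets. Let \<open>C\<close> be the group of
  those elements of \<open>B\<close> that preserve \<open>K\<close>. If the product with \<open>B\<close> is smaller than \<open>K B\<close>, then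
  some coset \<open>p C\<close> is covered by \<open>\<L>\<close>, and Neumann's lemma provides \<open>L \<in> \<L>\<close> such that the
  translations preserving \<open>M = L \<inter> K\<close> have finite index in \<open>C\<close>. Hence \<open>M C\<close>, the part of \<open>K\<close> that
  lies in \<open>M B\<close>, is a union of finitely many translates of \<open>M\<close>. Outside \<open>M B\<close> removing \<open>L\<close> has no
  effect, and inside it what remains of \<open>K\<close> after removing \<open>L\<close> consists of the translates of \<open>M\<close>
  other than \<open>M\<close> itself. Both parts involve only \<open>\<L> - {L}\<close>.\<close>

lemma coset_difference_set_mult:
  assumes B: "subgroup B G" and abelian: "\<And>a b. \<lbrakk>a \<in> B; b \<in> B\<rbrakk> \<Longrightarrow> a \<otimes> b = b \<otimes> a"
    and "finite \<L>" "\<And>L. L \<in> \<L> \<Longrightarrow> is_coset G L" and "is_coset G K"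
    and "\<And>k l b. \<lbrakk>k \<in> K; l \<in> K; b \<in> B\<rbrakk> \<Longrightarrow> inv k \<otimes> l \<otimes> b = b \<otimes> (inv k \<otimes> l)"
  shows "(K - \<Union>\<L>) <#> B \<in> coset_algebra G"
  using assms(3-)
proof (induction \<L> arbitrary: K rule: finite_psubset_induct)
  case (psubset \<L> K)
  interpret B: subgroup B G by fact
  note coset_L = psubset.prems(1) and coset_K = psubset.prems(2) and comm = psubset.prems(3)
  have K: "K \<subseteq> carrier G"
    using coset_K by (simp add: is_coset_def)
  define C where "C = periods B K"
  have C: "subgroup C G"
    unfolding C_def by (rule subgroup_periods[OF B coset_K])
  interpret C: subgroup C G by (rule C)
  have CB: "C \<subseteq> B" by (auto simp: C_def periods_def)
  show ?case
  proof (cases "K <#> B \<subseteq> (K - \<Union>\<L>) <#> B")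
    case True
    then have "(K - \<Union>\<L>) <#> B = K <#> B"
      unfolding set_mult_def by blast
    then show ?thesis
      using is_coset_set_mult[OF B coset_K comm] coset_in_coset_algebra by simp
  next
    case False
    then obtain p b where p: "p \<in> K" "b \<in> B" and pb: "p \<otimes> b \<notin> (K - \<Union>\<L>) <#> B"
      unfolding set_mult_def by blast
    have pC: "p \<in> carrier G" using p K by blast
    \<comment> \<open>A point \<open>p c\<close> outside all of \<open>\<L>\<close> would put \<open>p b = (p c) (c\<inverse> b)\<close> into the product.\<close>
    have cover: "\<exists>L\<in>\<L>. p \<otimes> c \<in> L" if c: "c \<in> C" for c
    proof (rule ccontr)
      assume "\<not> ?thesis"
      then have "p \<otimes> c \<in> K - \<Union>\<L>"
        using c p(1) by (auto simp: C_def periods_def)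
      moreover have "inv c \<otimes> b \<in> B"
        using c CB p(2) by auto
      moreover have "(p \<otimes> c) \<otimes> (inv c \<otimes> b) = p \<otimes> b"
        using c pC p(2) by (simp add: m_assoc cancel_inv_mult)
      ultimately show False
        using pb set_mult_memI[of "p \<otimes> c" "K - \<Union>\<L>" "inv c \<otimes> b" B] by simp
    qed
    define N where "N L = periods C (L \<inter> K)" for L
    define r where "r L = (SOME c. c \<in> C \<and> p \<otimes> c \<in> L)" for L
    define S where "S = r ` {L \<in> \<L>. \<exists>c\<in>C. p \<otimes> c \<in> L}"
    have r: "r L \<in> C \<and> p \<otimes> r L \<in> L" if "\<exists>c\<in>C. p \<otimes> c \<in> L" for L
      unfolding r_def by (rule someI_ex) (use that in blast)
    have "\<exists>M\<in>N ` \<L>. \<exists>S'. finite S' \<and> S' \<subseteq> C \<and> C \<subseteq> S' <#> M"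
    proof (rule neumann_covering)
      show "finite (N ` \<L>)" "finite S"
        using psubset.hyps by (auto simp: S_def)
      show "subgroup M G \<and> M \<subseteq> C" if "M \<in> N ` \<L>" for M
        using that subgroup_periods[OF C is_coset_Int[OF coset_L coset_K]]
        by (auto simp: N_def periods_def)
      show "S \<subseteq> C" using r by (auto simp: S_def)
      show "C \<subseteq> (\<Union>M\<in>N ` \<L>. S <#> M)"
      proof
        fix c assume c: "c \<in> C"
        then obtain L where L: "L \<in> \<L>" "p \<otimes> c \<in> L" using cover by blast
        then have rL: "r L \<in> C" "p \<otimes> r L \<in> L" using r c by blast+
        have "(p \<otimes> r L) \<otimes> (inv (r L) \<otimes> c) = p \<otimes> c"
          using c pC rL by (simp add: m_assoc cancel_inv_mult)
        moreover have "p \<otimes> c \<in> K" "p \<otimes> r L \<in> K"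
          using c rL(1) p(1) by (auto simp: C_def periods_def)
        ultimately have "inv (r L) \<otimes> c \<in> N L"
          unfolding N_def using c rL L
          by (intro periodsI[of C _ "p \<otimes> r L"] C is_coset_Int coset_L coset_K) auto
        moreover have "r L \<in> S"
          using c L rL by (auto simp: S_def)
        ultimately have "r L \<otimes> (inv (r L) \<otimes> c) \<in> S <#> N L"
          by (intro set_mult_memI)
        then have "c \<in> S <#> N L"
          using c rL by (simp add: cancel_inv_mult)
        then show "c \<in> (\<Union>M\<in>N ` \<L>. S <#> M)" using L by blast
      qed
    qed (rule C)
    then obtain L S' where L: "L \<in> \<L>" and S': "finite S'" "S' \<subseteq> C" "C \<subseteq> S' <#> N L"
      by blast
    define M where "M = L \<inter> K"
    define \<L>' where "\<L>' = \<L> - {L}"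
    \<comment> \<open>A translate of \<open>M\<close> that meets \<open>M\<close> equals \<open>M\<close>, and is removed together with \<open>L\<close>.\<close>
    define S'' where "S'' = {s \<in> S'. (M #> s) \<inter> M = {}}"
    have coset_M: "is_coset G M"
      unfolding M_def using L by (intro is_coset_Int coset_L coset_K)
    have MK: "M \<subseteq> K" by (auto simp: M_def)
    have \<L>': "\<L>' \<subset> \<L>" "\<And>L. L \<in> \<L>' \<Longrightarrow> is_coset G L"
      using L coset_L by (auto simp: \<L>'_def)
    have translate_K: "M #> s \<subseteq> K" if "s \<in> S'" for s
      using that S'(2) MK by (auto simp: r_coset_def C_def periods_def)
    have split: "(K - \<Union>\<L>) <#> B =
        (((K - \<Union>\<L>') <#> B) - (M <#> B)) \<union> (\<Union>s\<in>S''. ((M #> s) - \<Union>\<L>') <#> B)"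
      (is "?lhs = ?rhs")
    proof (intro equalityI subsetI)
      fix y assume "y \<in> ?lhs"
      then obtain x b where x: "x \<in> K" "x \<notin> \<Union>\<L>" "b \<in> B" "y = x \<otimes> b"
        unfolding set_mult_def by blast
      then have x': "x \<in> K - \<Union>\<L>'" by (auto simp: \<L>'_def)
      show "y \<in> ?rhs"
      proof (cases "y \<in> M <#> B")
        case False
        then show ?thesis using set_mult_memI[OF x' x(3)] x(4) by blast
      next
        case True
        then obtain m b' where m: "m \<in> M" "b' \<in> B" "x \<otimes> b = m \<otimes> b'"
          unfolding x(4) set_mult_def by blast
        have car: "x \<in> carrier G" "m \<in> carrier G" "b \<in> carrier G" "b' \<in> carrier G"
          using x m MK K by auto
        have eq: "x = m \<otimes> (b' \<otimes> inv b)"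
          using car arg_cong[OF m(3), of "\<lambda>z. z \<otimes> inv b"] by (simp add: m_assoc)
        have "b' \<otimes> inv b \<in> C"
          unfolding C_def
        proof (rule periodsI[OF B coset_K])
          show "m \<in> K" "m \<otimes> (b' \<otimes> inv b) \<in> K"
            using m(1) MK x(1) by (auto simp flip: eq)
          show "b' \<otimes> inv b \<in> B"
            using m(2) x(3) by simp
        qed
        then obtain s n where s: "s \<in> S'" "n \<in> N L" "b' \<otimes> inv b = s \<otimes> n"
          using S'(3) unfolding set_mult_def by blast
        have sn: "s \<in> B" "n \<in> B"
          using s S'(2) CB by (auto simp: N_def periods_def)
        then have "x = (m \<otimes> n) \<otimes> s"
          using eq s(3) abelian[of s n] car by (simp add: m_assoc)
        moreover have "m \<otimes> n \<in> M"
          using m(1) s(2) by (auto simp: N_def periods_def M_def)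
        ultimately have xs: "x \<in> M #> s"
          unfolding r_coset_def by blast
        have "(M #> s) \<inter> M = {}"
        proof (rule ccontr)
          assume "(M #> s) \<inter> M \<noteq> {}"
          then obtain m' where m': "m' \<in> M" "m' \<otimes> s \<in> M"
            unfolding r_coset_def by blast
          then have "s \<in> periods B M"
            using periodsI[OF B coset_M] sn by blast
          then have "x \<in> M"
            using xs by (auto simp: periods_def r_coset_def)
          then show False using x(2) L by (auto simp: M_def)
        qed
        then have "s \<in> S''" using s(1) by (simp add: S''_def)
        then have "x \<otimes> b \<in> (\<Union>s\<in>S''. ((M #> s) - \<Union>\<L>') <#> B)"
          using xs x x' by (intro UN_I set_mult_memI) auto
        then show ?thesis using x(4) by blast
      qed
    next
      fix y assume "y \<in> ?rhs"
      then consider x b where "x \<in> K" "x \<notin> \<Union>\<L>'" "b \<in> B" "y = x \<otimes> b" "y \<notin> M <#> B"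
        | x b s where "s \<in> S''" "x \<in> M #> s" "x \<notin> \<Union>\<L>'" "b \<in> B" "y = x \<otimes> b"
        unfolding set_mult_def by blast
      then show "y \<in> ?lhs"
      proof cases
        case 1
        then have "x \<notin> M" using set_mult_memI[of x M b B] by blast
        then have "x \<in> K - \<Union>\<L>" using 1 by (auto simp: \<L>'_def M_def)
        then show ?thesis using 1 by (simp add: set_mult_memI)
      next
        case 2
        then have "x \<in> K" "x \<notin> M" using translate_K by (auto simp: S''_def)
        then have "x \<in> K - \<Union>\<L>" using 2 by (auto simp: \<L>'_def M_def)
        then show ?thesis using 2 by (simp add: set_mult_memI)
      qed
    qed
    have "(K - \<Union>\<L>') <#> B \<in> coset_algebra G"
      using psubset.IH[OF \<L>'(1) \<L>'(2) coset_K] comm by blast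
    moreover have "M <#> B \<in> coset_algebra G"
      by (intro coset_in_coset_algebra is_coset_set_mult B coset_M comm) (use MK in auto)
    moreover have "((M #> s) - \<Union>\<L>') <#> B \<in> coset_algebra G" if s: "s \<in> S''" for s
    proof (rule psubset.IH[OF \<L>'(1) \<L>'(2)])
      have s': "s \<in> S'" using s by (simp add: S''_def)
      then show "is_coset G (M #> s)"
        using S'(2) by (intro is_coset_translate coset_M) auto
      show "inv k \<otimes> l \<otimes> b = b \<otimes> (inv k \<otimes> l)"
        if "k \<in> M #> s" "l \<in> M #> s" "b \<in> B" for k l b
        using that translate_K[OF s'] comm by blast
    qed
    moreover have "finite S''" using S'(1) by (simp add: S''_def)
    ultimately show ?thesis
      unfolding split by (intro coset_algebra_Un coset_algebra_Diff coset_algebra_UN)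
  qed
qed

section \<open>Conjugacy saturations\<close>

lemma l_coset_quotient:
  assumes H: "subgroup H G" and t: "t \<in> carrier G" and kl: "k \<in> l_coset G t H" "l \<in> l_coset G t H"
  shows "inv k \<otimes> l \<in> H"
proof -
  interpret H: subgroup H G by (rule H)
  obtain a b where ab: "a \<in> H" "b \<in> H" "k = t \<otimes> a" "l = t \<otimes> b"
    using kl by (auto simp: l_coset_def)
  have "inv k \<otimes> l = inv a \<otimes> b"
    using t ab(1,2) by (simp add: ab(3,4) inv_mult_group m_assoc cancel_inv_mult)
  then show ?thesis using ab(1,2) by simp
qed

lemma is_coset_l_coset:
  assumes H: "subgroup H G" and t: "t \<in> carrier G"
  shows "is_coset G (l_coset G t H)"
  unfolding is_coset_def
proof (intro conjI ballI)
  interpret H: subgroup H G by (rule H)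
  show tH: "l_coset G t H \<subseteq> carrier G" by (rule l_coset_subset_G[OF H.subset t])
  fix x y z assume xyz: "x \<in> l_coset G t H" "y \<in> l_coset G t H" "z \<in> l_coset G t H"
  obtain a where a: "a \<in> H" "x = t \<otimes> a" using xyz(1) by (auto simp: l_coset_def)
  have "y \<in> carrier G" "z \<in> carrier G"
    using xyz tH by auto
  then have "x \<otimes> inv y \<otimes> z = t \<otimes> (a \<otimes> (inv y \<otimes> z))"
    using a t by (simp add: m_assoc)
  moreover have "a \<otimes> (inv y \<otimes> z) \<in> H"
    using a(1) l_coset_quotient[OF H t xyz(2,3)] by simp
  ultimately show "x \<otimes> inv y \<otimes> z \<in> l_coset G t H"
    by (auto simp: l_coset_def)
qed
lemma coset_algebra_Int_left_coset_set_mult: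
  assumes E: "E \<in> coset_algebra G" and H: "subgroup H G"
    and abelian: "\<And>a b. \<lbrakk>a \<in> H; b \<in> H\<rbrakk> \<Longrightarrow> a \<otimes> b = b \<otimes> a"
    and t: "t \<in> carrier G" and B: "subgroup B G" "B \<subseteq> H"
  shows "(E \<inter> l_coset G t H) <#> B \<in> coset_algebra G"
proof -
  interpret H: subgroup H G by (rule H)
  note quotient = l_coset_quotient[OF H t] and coset_tH = is_coset_l_coset[OF H t]
  obtain \<D> where \<D>: "finite \<D>" "\<D> \<subseteq> coset_differences G" "E = \<Union>\<D>"
    using coset_algebra_normal_form[OF E] .
  have "(D \<inter> l_coset G t H) <#> B \<in> coset_algebra G" if "D \<in> \<D>" for D
  proof -
    have "D \<in> coset_differences G"
      using \<D>(2) that by blast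
    then obtain K \<L> where K: "D = K - \<Union>\<L>" "is_coset G K" "finite \<L>" "\<forall>L\<in>\<L>. is_coset G L"
      unfolding coset_differences_def by blast
    have "(K \<inter> l_coset G t H - \<Union>\<L>) <#> B \<in> coset_algebra G"
    proof (rule coset_difference_set_mult[OF B(1) _ K(3)])
      show "a \<otimes> b = b \<otimes> a" if "a \<in> B" "b \<in> B" for a b
        using abelian B(2) that by blast
      show "is_coset G L" if "L \<in> \<L>" for L
        using K(4) that by blast
      show "is_coset G (K \<inter> l_coset G t H)"
        by (rule is_coset_Int[OF K(2) coset_tH])
      show "inv k \<otimes> l \<otimes> b = b \<otimes> (inv k \<otimes> l)"
        if "k \<in> K \<inter> l_coset G t H" "l \<in> K \<inter> l_coset G t H" "b \<in> B" for k l b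
        using quotient that B(2) by (intro abelian) auto
    qed
    moreover have "D \<inter> l_coset G t H = K \<inter> l_coset G t H - \<Union>\<L>"
      using K(1) by blast
    ultimately show ?thesis by simp
  qed
  then have "(\<Union>D\<in>\<D>. (D \<inter> l_coset G t H) <#> B) \<in> coset_algebra G"
    by (intro coset_algebra_UN[OF \<D>(1)])
  moreover have "(E \<inter> l_coset G t H) <#> B = (\<Union>D\<in>\<D>. (D \<inter> l_coset G t H) <#> B)"
    by (auto simp: \<D>(3) set_mult_def)
  ultimately show ?thesis by simp
qed

text \<open>The representatives \<open>S\<close> show that \<open>H \<inter> tHt\<inverse>\<close> has finite index: the left coset of \<open>g\<close> modulo this
  subgroup is determined by the cosets \<open>gH\<close> and \<open>gtH\<close>. These are recorded through their inverses,
  which are right cosets.\<close>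

lemma finite_index_conjugate_Int:
  assumes H: "subgroup H G" and fin: "finite (rcosets H)" and t: "t \<in> carrier G"
  obtains S where "finite S" "S \<subseteq> carrier G"
    "\<And>g. g \<in> carrier G \<Longrightarrow> \<exists>s\<in>S. inv s \<otimes> g \<in> H \<and> inv t \<otimes> (inv s \<otimes> g) \<otimes> t \<in> H"
proof -
  interpret H: subgroup H G by (rule H)
  define f where "f g = (H #> inv g, H #> inv (g \<otimes> t))" for g
  have "f ` carrier G \<subseteq> (rcosets H) \<times> (rcosets H)"
    using t H.subset by (auto simp: f_def intro!: rcosetsI)
  then have "finite (f ` carrier G)"
    using fin finite_subset by blast
  then obtain S where S: "S \<subseteq> carrier G" "finite S" "f ` carrier G = f ` S"
    using finite_subset_image[of "f ` carrier G" f "carrier G"] by blast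
  have rep: "inv x \<otimes> y \<in> H" if eq: "H #> inv x = H #> inv y" and "x \<in> carrier G" "y \<in> carrier G" for x y
  proof -
    have "inv x \<in> H #> inv y"
      using rcos_self[of "inv x" H] that H by simp
    then obtain h where "h \<in> H" "inv x = h \<otimes> inv y"
      unfolding r_coset_def by blast
    then show ?thesis
      using that by (simp add: m_assoc)
  qed
  have "\<exists>s\<in>S. inv s \<otimes> g \<in> H \<and> inv t \<otimes> (inv s \<otimes> g) \<otimes> t \<in> H" if g: "g \<in> carrier G" for g
  proof -
    obtain s where s: "s \<in> S" "f s = f g"
      using S(3) g by (metis imageE imageI)
    have sG: "s \<in> carrier G" using s S by blast
    have "inv s \<otimes> g \<in> H"
      using s sG g by (intro rep) (auto simp: f_def)
    moreover have "inv (s \<otimes> t) \<otimes> (g \<otimes> t) \<in> H"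
      using s sG g t by (intro rep) (auto simp: f_def)
    ultimately show ?thesis
      using s sG g t by (auto simp: inv_mult_group m_assoc)
  qed
  then show thesis using that S by blast
qed

text \<open>Conjugation by a finite-index subgroup acts on each piece \<open>E \<inter> tH\<close> as multiplication by a
  subgroup of the abelian group \<open>H\<close>.\<close>

lemma coset_algebra_conjugacy_saturation:
  assumes va: "virtually_abelian G" and E: "E \<in> coset_algebra G"
  shows "(\<Union>x\<in>E. conjugacy_class G x) \<in> coset_algebra G"
proof -
  obtain H where H: "subgroup H G" and cH: "comm_group (G\<lparr>carrier := H\<rparr>)"
    and fin: "finite (rcosets H)"
    using va unfolding virtually_abelian_def by blast
  interpret H: subgroup H G by (rule H)
  have abelian: "a \<otimes> b = b \<otimes> a" if "a \<in> H" "b \<in> H" for a b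
    using comm_monoid.m_comm[OF comm_group.axioms(1)[OF cH], of a b] that by simp
  have EG: "E \<subseteq> carrier G" using coset_algebra_subset[OF E] .
  \<comment> \<open>The case \<open>t = \<one>\<close> gives representatives for \<open>G / H\<close>.\<close>
  obtain R where R: "finite R" "R \<subseteq> carrier G"
    "\<And>g. g \<in> carrier G \<Longrightarrow> \<exists>t\<in>R. inv t \<otimes> g \<in> H"
    using finite_index_conjugate_Int[OF H fin one_closed] by metis
  have piece: "(\<Union>x\<in>E \<inter> l_coset G t H. conjugacy_class G x) \<in> coset_algebra G" if "t \<in> R" for t
  proof -
    have t: "t \<in> carrier G" using that R by blast
    \<comment> \<open>\<open>A = H \<inter> tHt\<inverse>\<close>\<close>
    define A where "A = {a \<in> H. inv t \<otimes> a \<otimes> t \<in> H}"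
    define \<phi> where "\<phi> a = inv t \<otimes> a \<otimes> t \<otimes> inv a" for a
    define B where "B = \<phi> ` A"
    have A: "a \<in> carrier G" "a \<in> H" "inv t \<otimes> a \<otimes> t \<in> H" if "a \<in> A" for a
      using that by (auto simp: A_def)
    obtain S where S: "finite S" "S \<subseteq> carrier G"
      "\<And>g. g \<in> carrier G \<Longrightarrow> \<exists>s\<in>S. inv s \<otimes> g \<in> A"
      using finite_index_conjugate_Int[OF H fin t] unfolding A_def by (metis (lifting) mem_Collect_eq)
    have conj_mult: "inv t \<otimes> (a \<otimes> b) \<otimes> t = (inv t \<otimes> a \<otimes> t) \<otimes> (inv t \<otimes> b \<otimes> t)"
      if "a \<in> carrier G" "b \<in> carrier G" for a b
      using that t by (simp add: m_assoc cancel_inv_mult)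
    have conj_inv: "inv t \<otimes> inv a \<otimes> t = inv (inv t \<otimes> a \<otimes> t)" if "a \<in> carrier G" for a
      using that t by (simp add: m_assoc inv_mult_group)
    have sub_A: "subgroup A G"
    proof (rule subgroupI)
      show "A \<subseteq> carrier G" using A by blast
      have "\<one> \<in> A" using t by (simp add: A_def)
      then show "A \<noteq> {}" by blast
      show "inv a \<in> A" if "a \<in> A" for a
        using A[OF that] conj_inv[of a] by (simp add: A_def)
      show "a \<otimes> b \<in> A" if "a \<in> A" "b \<in> A" for a b
        using A[OF that(1)] A[OF that(2)] conj_mult[of a b] by (simp add: A_def)
    qed
    interpret A: subgroup A G by (rule sub_A)
    have \<phi>_H: "\<phi> a \<in> H" if "a \<in> A" for a
      using A[OF that] by (simp add: \<phi>_def)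
    have \<phi>_mult: "\<phi> (a \<otimes> b) = \<phi> a \<otimes> \<phi> b" if "a \<in> A" "b \<in> A" for a b
    proof -
      define a' b' where "a' = inv t \<otimes> a \<otimes> t" and "b' = inv t \<otimes> b \<otimes> t"
      have H': "a \<in> H" "b \<in> H" "a' \<in> H" "b' \<in> H"
        using A that by (auto simp: a'_def b'_def)
      then have G': "a \<in> carrier G" "b \<in> carrier G" "a' \<in> carrier G" "b' \<in> carrier G"
        by auto
      have "\<phi> (a \<otimes> b) = a' \<otimes> (b' \<otimes> inv b \<otimes> inv a)"
        using G' by (simp add: \<phi>_def conj_mult inv_mult_group m_assoc flip: a'_def b'_def)
      also have "b' \<otimes> inv b \<otimes> inv a = inv a \<otimes> (b' \<otimes> inv b)"
        using H' by (intro abelian) auto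
      also have "a' \<otimes> \<dots> = \<phi> a \<otimes> \<phi> b"
        using G' by (simp add: \<phi>_def m_assoc flip: a'_def b'_def)
      finally show ?thesis .
    qed
    have sub_B: "subgroup B G"
    proof -
      interpret \<phi>: group_hom "G\<lparr>carrier := A\<rparr>" G \<phi>
      proof (intro group_hom.intro group_hom_axioms.intro homI)
        show "group (G\<lparr>carrier := A\<rparr>)" by (rule A.subgroup_is_group) (rule is_group)
      qed (use \<phi>_mult \<phi>_H in \<open>auto\<close>)
      show ?thesis using \<phi>.img_is_subgroup by (simp add: B_def)
    qed
    have BH: "B \<subseteq> H" using \<phi>_H by (auto simp: B_def)
    \<comment> \<open>Writing \<open>x = t h\<close>, the conjugate is \<open>t (t\<inverse>at) h a\<inverse>\<close>, and \<open>t\<inverse>at\<close> commutes with \<open>h\<close>.\<close>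
    have conj_A: "a \<otimes> x \<otimes> inv a = x \<otimes> \<phi> a" if a: "a \<in> A" and x: "x \<in> l_coset G t H" for a x
    proof -
      obtain h where h: "h \<in> H" "x = t \<otimes> h" using x by (auto simp: l_coset_def)
      define a' where "a' = inv t \<otimes> a \<otimes> t"
      have a': "a' \<in> H" "a \<in> carrier G" using A a by (auto simp: a'_def)
      have "a \<otimes> x \<otimes> inv a = t \<otimes> (a' \<otimes> h) \<otimes> inv a"
        using a' h t by (simp add: a'_def m_assoc cancel_inv_mult)
      also have "a' \<otimes> h = h \<otimes> a'" using abelian a' h by blast
      also have "t \<otimes> \<dots> \<otimes> inv a = x \<otimes> (a' \<otimes> inv a)"
        using a' h t by (simp add: m_assoc)
      finally show ?thesis by (simp add: \<phi>_def a'_def)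
    qed
    define F where "F = (E \<inter> l_coset G t H) <#> B"
    have "(\<Union>x\<in>E \<inter> l_coset G t H. conjugacy_class G x) = (\<Union>s\<in>S. (\<lambda>x. s \<otimes> x \<otimes> inv s) ` F)"
      (is "?lhs = ?rhs")
    proof (intro equalityI subsetI)
      fix z assume "z \<in> ?lhs"
      then obtain x g where x: "x \<in> E" "x \<in> l_coset G t H" "g \<in> carrier G" "z = g \<otimes> x \<otimes> inv g"
        unfolding conjugacy_class_def by blast
      obtain s where s: "s \<in> S" "inv s \<otimes> g \<in> A" using S(3) x(3) by blast
      define a where "a = inv s \<otimes> g"
      have car: "s \<in> carrier G" "a \<in> carrier G" "x \<in> carrier G"
        using s S x EG A by (auto simp: a_def)
      have "g = s \<otimes> a" using car x(3) by (simp add: a_def cancel_inv_mult)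
      then have "z = s \<otimes> (a \<otimes> x \<otimes> inv a) \<otimes> inv s"
        using car by (simp add: x(4) inv_mult_group m_assoc)
      also have "a \<otimes> x \<otimes> inv a = x \<otimes> \<phi> a"
        using conj_A s x by (simp add: a_def)
      finally have "z = s \<otimes> (x \<otimes> \<phi> a) \<otimes> inv s" .
      moreover have "x \<otimes> \<phi> a \<in> F"
        unfolding F_def B_def a_def using x s by (intro set_mult_memI) auto
      ultimately show "z \<in> ?rhs" using s(1) by blast
    next
      fix z assume "z \<in> ?rhs"
      then obtain s x a where s: "s \<in> S" "x \<in> E" "x \<in> l_coset G t H" "a \<in> A" "z = s \<otimes> (x \<otimes> \<phi> a) \<otimes> inv s"
        unfolding F_def B_def set_mult_def by blast
      have car: "s \<in> carrier G" "a \<in> carrier G" "x \<in> carrier G"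
        using s S EG A by auto
      have "z = s \<otimes> (a \<otimes> x \<otimes> inv a) \<otimes> inv s"
        using s conj_A by simp
      then have "z = (s \<otimes> a) \<otimes> x \<otimes> inv (s \<otimes> a)"
        using car by (simp add: inv_mult_group m_assoc)
      then show "z \<in> ?lhs"
        using s car unfolding conjugacy_class_def by blast
    qed
    moreover have "F \<in> coset_algebra G"
      unfolding F_def
      by (rule coset_algebra_Int_left_coset_set_mult[OF E H abelian t sub_B BH])
    ultimately show ?thesis
      using S by (simp add: coset_algebra_UN coset_algebra_conjugate subset_iff)
  qed
  have "E = (\<Union>t\<in>R. E \<inter> l_coset G t H)"
  proof
    show "E \<subseteq> (\<Union>t\<in>R. E \<inter> l_coset G t H)"
    proof
      fix x assume x: "x \<in> E"
      then obtain t where t: "t \<in> R" "inv t \<otimes> x \<in> H" using R(3) EG by blast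
      have "x = t \<otimes> (inv t \<otimes> x)"
        using t x R EG by (simp add: subset_iff cancel_inv_mult)
      then have "x \<in> l_coset G t H" using t(2) by (auto simp: l_coset_def)
      then show "x \<in> (\<Union>t\<in>R. E \<inter> l_coset G t H)" using x t by blast
    qed
  qed blast
  then have "(\<Union>x\<in>E. conjugacy_class G x) = (\<Union>t\<in>R. \<Union>x\<in>E \<inter> l_coset G t H. conjugacy_class G x)"
    by blast
  then show ?thesis
    using coset_algebra_UN[OF R(1) piece] by simp
qed

end

lemma (in compact_group) closedin_conjugacy_saturation:
  assumes "closedin T E"
  shows "closedin T (\<Union>x\<in>E. conjugacy_class G x)"
proof -
  let ?P = "prod_topology T T"
  let ?f = "\<lambda>p. fst p \<otimes> snd p \<otimes> inv (fst p)"
  have mult: "continuous_map ?P T (\<lambda>p. f p \<otimes> g p)"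
    if "continuous_map ?P T f" "continuous_map ?P T g" for f g
    using continuous_map_compose[OF continuous_map_pairedI[OF that] continuous_mult]
    by (simp add: o_def)
  have fst: "continuous_map ?P T fst" and snd: "continuous_map ?P T snd"
    by (rule continuous_map_fst continuous_map_snd)+
  have "continuous_map ?P T (\<lambda>p. inv (fst p))"
    using continuous_map_compose[OF fst continuous_inv] by (simp add: o_def)
  then have "continuous_map ?P T ?f"
    using mult fst snd by blast
  moreover have "compactin ?P (carrier G \<times> E)"
    using compact_space_T closedin_compact_space[OF compact_space_T assms]
    by (simp add: compactin_Times compact_space_def topspace_eq)
  ultimately have "compactin T (?f ` (carrier G \<times> E))"
    by (rule image_compactin[rotated])
  moreover have "?f ` (carrier G \<times> E) = (\<Union>x\<in>E. conjugacy_class G x)"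
    unfolding conjugacy_class_def by force
  ultimately show ?thesis
    using compactin_imp_closedin[OF Hausdorff_space_T] by simp
qed

theorem proposition3p12:
  fixes G :: "('a, 'b) monoid_scheme" and T :: "'a topology" and E :: "'a set"
  assumes "compact_group G T"
    and "virtually_abelian G"
    and "E \<in> closed_coset_algebra G T"
  shows "(\<Union>x\<in>E. conjugacy_class G x) \<in> closed_coset_algebra G T"
proof -
  interpret compact_group G T by fact
  show ?thesis
    using assms(2,3) coset_algebra_conjugacy_saturation closedin_conjugacy_saturation
    by (simp add: closed_coset_algebra_def)
qed

end
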